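(* Let $G$ be a strongly connected digraph of order $p\geq 4$ such that $d(x)+d(y)\geq 2p-1$ for every pair of non-adjacent vertices $x,y$ of $G$. Then $G$ contains a $D(p,3)$, i.e., there exist distinct vertices $u,w,v$ such that $uw,wv\in E(G)$ and there is a $(u,v)$-path of length $p-2$ in $G$ containing all vertices of $G$ other than $w$.
   Context: Digraphs are finite, without loops and without multiple arcs (a pair of opposite arcs $xy,yx$ is allowed). For a vertex $x$, $d(x)=od(x)+id(x)$ is the sum of its out-degree and in-degree. Two distinct vertices are adjacent if at least one of the arcs $xy$, $yx$ is present. Paths are simple and directed. $D(p,3)$ denotes the digraph of order $p$ consisting of two internally disjoint paths from a vertex $u$ to a vertex $v$, one of length $2$ and one of length $p-2$, covering all $p$ vertices. *)

theory Defs
  imports "Graph_Theory.Graph_Theory"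
begin

text \<open>
  Digraphs in the sense of the statement (finite, without loops and without multiple arcs, opposite
  arcs allowed) are the library locale \<open>digraph\<close>.
\<close>

definition total_degree :: "('a, 'b) pre_digraph \<Rightarrow> 'a \<Rightarrow> nat" where
  "total_degree G x = out_degree G x + in_degree G x"

definition adjacent :: "('a, 'b) pre_digraph \<Rightarrow> 'a \<Rightarrow> 'a \<Rightarrow> bool" where
  "adjacent G x y \<longleftrightarrow> x \<noteq> y \<and> (x \<rightarrow>\<^bsub>G\<^esub> y \<or> y \<rightarrow>\<^bsub>G\<^esub> x)"

end

theory Submission
  imports Defs
begin

text \<open>Reversing all arcs at a vertex \<open>w\<close> changes neither adjacency nor total degrees, and it turns
  a Hamiltonian cycle into a \<open>D(p,3)\<close> with middle vertex \<open>w\<close>. By Meyniel's theorem it therefore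
  suffices that the modified digraph is strong for some \<open>w\<close>, which holds as soon as \<open>G - w\<close> is
  strong. Such a \<open>w\<close> exists: non-adjacent vertices are joined by at least three directed paths of
  length two, and this is violated around a cut vertex that splits off a set of minimum size.
  Meyniel's theorem is proved following Bondy and Thomassen: take a longest cycle and an ear of it
  that skips as few cycle vertices as possible; some skipped vertex and the first vertex of the ear
  are non-adjacent and have too small a degree sum.\<close>

section \<open>Paths as vertex lists\<close>

text \<open>Collecting the arcs of a vertex list turns "is a path of \<open>E\<close>" into an
  inclusion, and cutting or gluing paths into list append.\<close>

fun steps :: "'a list \<Rightarrow> 'a rel" where
  "steps (x # y # zs) = insert (x, y) (steps (y # zs))"
| "steps [x] = {}"
| "steps [] = {}"

lemma steps_append:
  "xs \<noteq> [] \<Longrightarrow> ys \<noteq> [] \<Longrightarrow> steps (xs @ ys) = steps xs \<union> {(last xs, hd ys)} \<union> steps ys"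
proof (induction xs rule: steps.induct)
  case (2 x)
  then show ?case by (cases ys) auto
qed auto

lemma steps_Cons: "ys \<noteq> [] \<Longrightarrow> steps (x # ys) = insert (x, hd ys) (steps ys)"
  by (cases ys) auto

lemma steps_split: "(a, b) \<in> steps xs \<Longrightarrow> \<exists>A B. xs = A @ a # b # B"
proof (induction xs rule: steps.induct)
  case (1 x y zs)
  show ?case
  proof (cases "(a, b) = (x, y)")
    case True
    then show ?thesis by (metis append_Nil prod.inject)
  next
    case False
    then obtain A B where "y # zs = A @ a # b # B"
      using 1 by auto
    then show ?thesis by (metis append_Cons)
  qed
qed auto

text \<open>When the new first vertex already occurs on the path, everything before that occurrence
  is dropped. The bound on \<open>set p\<close> later confines paths of a restricted relation to the
  restricting set.\<close>

lemma rtrancl_distinct_list: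
  assumes "(x, y) \<in> r\<^sup>*"
  shows "\<exists>p. p \<noteq> [] \<and> hd p = x \<and> last p = y \<and> distinct p \<and> steps p \<subseteq> r
    \<and> set p \<subseteq> insert y (Domain r)"
  using assms
proof (induction rule: converse_rtrancl_induct)
  case base
  show ?case by (rule exI[of _ "[y]"]) auto
next
  case (step x z)
  then obtain p where p: "p \<noteq> []" "hd p = z" "last p = y" "distinct p" "steps p \<subseteq> r"
    "set p \<subseteq> insert y (Domain r)" by blast
  show ?case
  proof (cases "x \<in> set p")
    case True
    then obtain as bs where s: "p = as @ x # bs" by (meson split_list)
    have "steps (x # bs) \<subseteq> steps p"
      unfolding s by (cases "as = []") (auto simp: steps_append)
    then show ?thesis
      using p s by (intro exI[of _ "x # bs"]) auto
  next
    case False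
    then show ?thesis
      using p step.hyps(1) by (intro exI[of _ "x # p"]) (auto simp: steps_Cons)
  qed
qed

section \<open>Inserting vertices into a path\<close>

definition insertable :: "'a rel \<Rightarrow> 'a list \<Rightarrow> 'a \<Rightarrow> bool" where
  "insertable E P y \<longleftrightarrow> (\<exists>(a, b) \<in> steps P. (a, y) \<in> E \<and> (y, b) \<in> E)"

text \<open>The longest initial segment of \<open>Q\<close> whose last vertex fits between the same two vertices as
  the first one is inserted there as a block; the places of the remaining vertices survive.\<close>

lemma multi_insertion:
  assumes "steps P \<subseteq> E" "steps Q \<subseteq> E" "distinct (P @ Q)" "P \<noteq> []"
    and "\<And>y. y \<in> set Q \<Longrightarrow> insertable E P y"
  shows "\<exists>P'. P' \<noteq> [] \<and> hd P' = hd P \<and> last P' = last P \<and> distinct P'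
    \<and> set P' = set P \<union> set Q \<and> steps P' \<subseteq> E"
  using assms
proof (induction "length Q" arbitrary: P Q rule: less_induct)
  case less
  show ?case
  proof (cases Q)
    case Nil
    then show ?thesis using less.prems by auto
  next
    case (Cons y ys)
    then obtain a b where ab: "(a, b) \<in> steps P" "(a, y) \<in> E" "(y, b) \<in> E"
      using less.prems(5)[of y] by (auto simp: insertable_def)
    obtain A B where P: "P = A @ a # b # B"
      using steps_split[OF ab(1)] by blast
    define fits where "fits = (\<lambda>z. (a, z) \<in> E \<and> (z, b) \<in> E)"
    have "\<exists>z\<in>set Q. fits z" using ab Cons by (auto simp: fits_def)
    then obtain Q1 z Q2 where Q: "Q = Q1 @ z # Q2" and z: "fits z" and Q2: "\<forall>z\<in>set Q2. \<not> fits z"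
      by (metis split_list_last_prop)
    define S where "S = Q1 @ [z]"
    have S: "S \<noteq> []" "hd S = y" "last S = z" "Q = S @ Q2"
      using Q Cons by (auto simp: S_def hd_append split: if_splits) (cases Q1; simp)
    have St: "steps S \<subseteq> E" "steps Q2 \<subseteq> E"
      using less.prems(2) S(1,4) by (cases "Q2 = []"; auto simp: steps_append)+
    define P1 where "P1 = (A @ [a]) @ S @ b # B"
    have stP: "steps P = steps (A @ [a]) \<union> {(a, b)} \<union> steps (b # B)"
      using steps_append[of "A @ [a]" "b # B"] P by simp
    have stP1: "steps P1 = steps (A @ [a]) \<union> {(a, y)} \<union> steps S \<union> {(z, b)} \<union> steps (b # B)"
      unfolding P1_def using S by (simp add: steps_append del: append.simps append_assoc) auto
    have "\<exists>P'. P' \<noteq> [] \<and> hd P' = hd P1 \<and> last P' = last P1 \<and> distinct P'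
      \<and> set P' = set P1 \<union> set Q2 \<and> steps P' \<subseteq> E"
    proof (rule less.hyps)
      show "length Q2 < length Q" using Q by simp
      show "steps P1 \<subseteq> E"
        using stP stP1 St(1) ab z less.prems(1) by (auto simp: fits_def)
      show "distinct (P1 @ Q2)"
        using less.prems(3) unfolding P1_def P S(4) by auto
      show "insertable E P1 w" if w: "w \<in> set Q2" for w
      proof -
        obtain a' b' where *: "(a', b') \<in> steps P" "(a', w) \<in> E" "(w, b') \<in> E"
          using less.prems(5)[of w] w S(4) by (auto simp: insertable_def)
        then have "(a', b') \<noteq> (a, b)" using Q2 w unfolding fits_def by blast
        then have "(a', b') \<in> steps P1" using *(1) unfolding stP stP1 by blast
        then show ?thesis using * unfolding insertable_def by blast
      qed
    qed (use St P1_def in auto)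
    moreover have "hd P1 = hd P" "last P1 = last P" "set P1 \<union> set Q2 = set P \<union> set Q"
      unfolding P1_def P S(4) by (auto simp: hd_append)
    ultimately show ?thesis by auto
  qed
qed

section \<open>Counting arcs between vertices\<close>

text \<open>Summed over all vertices \<open>y\<close> this is the total degree of \<open>x\<close>,
  so degrees can be estimated over parts of the vertex set.\<close>

definition links :: "'a rel \<Rightarrow> 'a \<Rightarrow> 'a \<Rightarrow> nat" where
  "links E x y = of_bool ((x, y) \<in> E) + of_bool ((y, x) \<in> E)"

lemma links_le_2: "links E x y \<le> 2"
  by (simp add: links_def)

text \<open>For each step \<open>(a, b)\<close> of \<open>P\<close> at most one of the arcs from
  \<open>a\<close> to \<open>x\<close> and from \<open>x\<close> to \<open>b\<close> exists. Only
  the arcs from \<open>x\<close> to \<open>hd P\<close> and from \<open>last P\<close> to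
  \<open>x\<close> belong to no such pair.\<close>

lemma sum_links_not_insertable:
  assumes "P \<noteq> []" "distinct P" "\<not> insertable E P x"
  shows "(\<Sum>z\<in>set P. links E x z) \<le> length P + 1"
proof -
  \<comment> \<open>The arc to the head is counted separately, because a vertex put in front pairs
    it with a new arc.\<close>
  have "(\<Sum>z\<in>set P. links E x z) \<le> length P + of_bool ((x, hd P) \<in> E)"
    using assms
  proof (induction P rule: steps.induct)
    case (1 a b zs)
    have "\<not> insertable E (b # zs) x" "\<not> ((a, x) \<in> E \<and> (x, b) \<in> E)"
      using 1(4) by (auto simp: insertable_def)
    moreover have "(\<Sum>z\<in>set (a # b # zs). links E x z) = links E x a + (\<Sum>z\<in>set (b # zs). links E x z)"
      using 1(3) by (subst list.set(2), subst sum.insert) auto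
    ultimately show ?case
      using 1 by (auto simp: links_def)
  qed (auto simp: links_def)
  then show ?thesis by (simp add: of_bool_def split: if_splits)
qed

section \<open>Strong connectivity by cuts\<close>

text \<open>Both ends of the crossing arc lie in \<open>V\<close>, so deleting a vertex is expressed
  by shrinking \<open>V\<close> alone.\<close>

definition strong :: "'a set \<Rightarrow> 'a rel \<Rightarrow> bool" where
  "strong V E \<longleftrightarrow> (\<forall>A. A \<subseteq> V \<longrightarrow> A \<noteq> {} \<longrightarrow> A \<noteq> V \<longrightarrow> (\<exists>a\<in>A. \<exists>b\<in>V - A. (a, b) \<in> E))"

lemma strongD:
  assumes "strong V E" "A \<subseteq> V" "A \<noteq> {}" "A \<noteq> V"
  obtains a b where "a \<in> A" "b \<in> V" "b \<notin> A" "(a, b) \<in> E"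
  using assms unfolding strong_def by (metis DiffD1 DiffD2)

text \<open>An arc leaving the complement of \<open>A\<close> is, reversed, an arc leaving
  \<open>A\<close>.\<close>

lemma strong_converse:
  assumes "strong V E"
  shows "strong V (E\<inverse>)"
  unfolding strong_def
proof (intro allI impI)
  fix A assume A: "A \<subseteq> V" "A \<noteq> {}" "A \<noteq> V"
  then obtain a b where "a \<in> V - A" "b \<in> V" "b \<notin> V - A" "(a, b) \<in> E"
    using strongD[OF assms, of "V - A"] by blast
  then show "\<exists>a\<in>A. \<exists>b\<in>V - A. (a, b) \<in> E\<inverse>" by blast
qed

lemma strong_reach:
  assumes "strong V E" "x \<in> V" "y \<in> V"
  shows "(x, y) \<in> E\<^sup>*"
proof (rule ccontr)
  assume n: "(x, y) \<notin> E\<^sup>*"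
  define S where "S = {z \<in> V. (x, z) \<in> E\<^sup>*}"
  have "S \<subseteq> V" "S \<noteq> {}" "S \<noteq> V" using assms n by (auto simp: S_def)
  then obtain a b where "a \<in> S" "b \<in> V" "b \<notin> S" "(a, b) \<in> E"
    using strongD[OF assms(1)] by metis
  then show False by (auto simp: S_def dest: rtrancl_into_rtrancl)
qed

section \<open>Meyniel's theorem\<close>

text \<open>The bound is \<open>d(x) + d(y) \<ge> 2n - 1\<close>, with the 1 moved across to avoid
  truncated subtraction.\<close>

locale meyniel =
  fixes V :: "'a set" and E :: "'a rel"
  assumes finite_V: "finite V"
    and E_sub: "E \<subseteq> V \<times> V"
    and E_irrefl: "(x, x) \<notin> E"
    and strong: "strong V E"
    and deg_sum: "\<lbrakk>x \<in> V; y \<in> V; x \<noteq> y; (x, y) \<notin> E; (y, x) \<notin> E\<rbrakk> \<Longrightarrow>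
      2 * card V \<le> (\<Sum>z\<in>V. links E x z) + (\<Sum>z\<in>V. links E y z) + 1"
begin

lemma links_self: "links E x x = 0"
  using E_irrefl by (simp add: links_def)

definition cyc :: "'a list \<Rightarrow> bool" where
  "cyc xs \<longleftrightarrow> xs \<noteq> [] \<and> distinct xs \<and> set xs \<subseteq> V \<and> steps xs \<subseteq> E \<and> (last xs, hd xs) \<in> E"

lemma cyc_rotate:
  assumes "cyc (A @ B)"
  shows "cyc (B @ A)"
proof (cases "A = [] \<or> B = []")
  case True
  then show ?thesis using assms by auto
next
  case False
  then show ?thesis using assms by (auto simp: cyc_def steps_append)
qed

text \<open>An arc from \<open>a\<close> to \<open>c\<close> is closed by a path from
  \<open>c\<close> back to \<open>a\<close>.\<close>

lemma ex_cyc: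
  assumes "2 \<le> card V"
  shows "\<exists>xs. cyc xs"
proof -
  obtain a where a: "a \<in> V" using assms by fastforce
  have "{a} \<noteq> V" using assms by auto
  then obtain c where c: "c \<in> V" "(a, c) \<in> E"
    using strongD[OF strong, of "{a}"] a by blast
  obtain p where "p \<noteq> []" "hd p = c" "last p = a" "distinct p" "steps p \<subseteq> E"
    "set p \<subseteq> insert a (Domain E)"
    using rtrancl_distinct_list[OF strong_reach[OF strong c(1) a]] by blast
  then have "cyc p" using a c E_sub by (auto simp: cyc_def)
  then show ?thesis ..
qed

text \<open>An ear of a cycle \<open>P @ Q\<close> leaves it at the last vertex of \<open>P\<close> and returns to the first one,
  so that \<open>Q\<close> is the gap which the ear skips. \<open>P\<close> may be a single vertex.\<close>

definition ear :: "'a list \<Rightarrow> 'a list \<Rightarrow> 'a \<Rightarrow> 'a \<Rightarrow> bool" where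
  "ear P Q x x' \<longleftrightarrow> cyc (P @ Q) \<and> P \<noteq> [] \<and> (last P, x) \<in> E \<and> (x', hd P) \<in> E
     \<and> x \<in> V - set (P @ Q) \<and> x' \<in> V - set (P @ Q)
     \<and> (x, x') \<in> (E \<inter> (V - set (P @ Q)) \<times> (V - set (P @ Q)))\<^sup>*"

lemma ex_ear:
  assumes "cyc C" "set C \<noteq> V"
  shows "\<exists>P Q x x'. ear P Q x x' \<and> length (P @ Q) = length C"
proof -
  let ?R = "V - set C" and ?r = "E \<inter> (V - set C) \<times> (V - set C)"
  have C: "set C \<subseteq> V" "C \<noteq> []" using assms(1) by (auto simp: cyc_def)
  obtain u x where u: "u \<in> set C" "x \<in> ?R" "(u, x) \<in> E"
    using strongD[OF strong C(1)] assms(2) C(2) by (metis DiffI set_empty)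
  \<comment> \<open>These are the vertices that \<open>x\<close> reaches without touching the cycle;
    an arc leaving this set can only end on the cycle.\<close>
  define S where "S = {z \<in> ?R. (x, z) \<in> ?r\<^sup>*}"
  have "S \<subseteq> V" "S \<noteq> {}" "S \<noteq> V" using u C by (auto simp: S_def)
  then obtain x' v where x': "x' \<in> S" "v \<in> V" "v \<notin> S" "(x', v) \<in> E"
    using strongD[OF strong] by metis
  have v: "v \<in> set C"
  proof (rule ccontr)
    assume "v \<notin> set C"
    then have "(x', v) \<in> ?r" using x' by (auto simp: S_def)
    then have "v \<in> S" using x' \<open>v \<notin> set C\<close> by (auto simp: S_def dest: rtrancl_into_rtrancl)
    then show False using x' by simp
  qed
  obtain A B where AB: "C = A @ v # B" using v by (meson split_list)
  \<comment> \<open>The rotation starts at the return vertex \<open>v\<close>; if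
    \<open>u = v\<close>, the segment \<open>P\<close> becomes a single vertex.\<close>
  define D where "D = (v # B) @ A"
  have D: "cyc D" "set D = set C" "length D = length C" "hd D = v"
    using cyc_rotate[of A "v # B"] assms(1) AB by (auto simp: D_def)
  obtain P' Q where PQ: "D = P' @ u # Q" using u D(2) by (metis split_list)
  have "D = (P' @ [u]) @ Q" using PQ by simp
  moreover have "hd (P' @ [u]) = v" using PQ D(4) by (auto simp: hd_append)
  ultimately have "ear (P' @ [u]) Q x x'"
    unfolding ear_def using D u x' by (auto simp: S_def)
  then show ?thesis using PQ D(3) by (metis append.assoc append_Cons append_Nil)
qed

theorem hamiltonian:
  assumes "2 \<le> card V"
  obtains C where "cyc C" "set C = V"
proof -
  have "\<exists>C. cyc C \<and> (\<forall>D. cyc D \<longrightarrow> length D \<le> length C)"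
  proof -
    have "length D \<le> card V" if "cyc D" for D
      using that finite_V unfolding cyc_def by (metis card_mono distinct_card)
    then show ?thesis
      using ex_cyc[OF assms] ex_has_greatest_nat[of cyc _ length "Suc (card V)"]
      by (metis less_Suc_eq_le)
  qed
  then obtain C where C: "cyc C" and max: "\<And>D. cyc D \<Longrightarrow> length D \<le> length C" by blast
  have "set C = V"
  proof (rule ccontr)
    assume "set C \<noteq> V"
    \<comment> \<open>The minimum is taken over the ears of all longest cycles in all rotations, so
      a re-cut cycle still competes.\<close>
    define gap where "gap n \<longleftrightarrow>
      (\<exists>P Q x x'. ear P Q x x' \<and> length (P @ Q) = length C \<and> length Q = n)" for n
    have "\<exists>n. gap n" using ex_ear[OF C \<open>set C \<noteq> V\<close>] unfolding gap_def by blast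
    then obtain n where n: "gap n" and least: "\<And>m. gap m \<Longrightarrow> n \<le> m"
      by (metis LeastI_ex Least_le)
    obtain P Q x x' where e: "ear P Q x x'" and len: "length (P @ Q) = length C"
      and Qn: "length Q = n"
      using n unfolding gap_def by blast
    define R where "R = V - set (P @ Q)"
    define r where "r = E \<inter> R \<times> R"
    have cy: "cyc (P @ Q)" and P: "P \<noteq> []" and ux: "(last P, x) \<in> E" and xv: "(x', hd P) \<in> E"
      and xR: "x \<in> R" and x'R: "x' \<in> R" and xx: "(x, x') \<in> r\<^sup>*"
      using e unfolding ear_def R_def r_def by auto
    have PQV: "set P \<subseteq> V" "set Q \<subseteq> V" and dist: "distinct P" "distinct Q" "set P \<inter> set Q = {}"
      using cy by (auto simp: cyc_def)
    have stPQ: "steps P \<subseteq> E" "steps Q \<subseteq> E"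
      using cy P by (cases "Q = []"; auto simp: cyc_def steps_append)+
    \<comment> \<open>Such an arc starts an ear at \<open>y\<close> that skips only the part of
      \<open>Q\<close> after \<open>y\<close>.\<close>
    have no_out: "(y, z) \<notin> E" if y: "y \<in> set Q" and z: "z \<in> R" "(z, x') \<in> r\<^sup>*" for y z
    proof
      assume yz: "(y, z) \<in> E"
      obtain Q1 Q2 where Q: "Q = Q1 @ y # Q2" using y by (meson split_list)
      have "ear (P @ Q1 @ [y]) Q2 z x'"
        using cy P xv x'R z yz unfolding ear_def R_def r_def Q by simp
      then have "gap (length Q2)" unfolding gap_def using len Q by fastforce
      then show False using least Qn Q by fastforce
    qed
    \<comment> \<open>Dually, the ear now returns at \<open>y\<close> and skips only the part of
      \<open>Q\<close> before \<open>y\<close>.\<close>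
    have no_in: "(z, y) \<notin> E" if y: "y \<in> set Q" and z: "z \<in> R" "(x, z) \<in> r\<^sup>*" for y z
    proof
      assume zy: "(z, y) \<in> E"
      obtain Q1 Q2 where Q: "Q = Q1 @ y # Q2" using y by (meson split_list)
      have "cyc ((y # Q2 @ P) @ Q1)" using cyc_rotate[of "P @ Q1" "y # Q2"] cy Q by simp
      moreover have "set ((y # Q2 @ P) @ Q1) = set (P @ Q)" using Q by auto
      ultimately have "ear (y # Q2 @ P) Q1 x z"
        using P ux xR z zy unfolding ear_def R_def r_def by (auto simp del: set_append)
      then have "gap (length Q1)" unfolding gap_def using len Q by fastforce
      then show False using least Qn Q by fastforce
    qed
    \<comment> \<open>Otherwise all of \<open>Q\<close> can be inserted into \<open>P\<close> with
      its ends kept, and a path from \<open>x\<close> to \<open>x'\<close> outside the cycle closes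
      the result to a longer cycle.\<close>
    obtain y where y: "y \<in> set Q" "\<not> insertable E P y"
    proof (rule ccontr)
      assume "\<not> thesis"
      then have "\<And>y. y \<in> set Q \<Longrightarrow> insertable E P y" using that by blast
      then obtain P' where P': "P' \<noteq> []" "hd P' = hd P" "last P' = last P" "distinct P'"
        "set P' = set P \<union> set Q" "steps P' \<subseteq> E"
        using multi_insertion[OF stPQ _ P] dist by (metis distinct_append)
      obtain X where X: "X \<noteq> []" "hd X = x" "last X = x'" "distinct X" "steps X \<subseteq> r"
        "set X \<subseteq> insert x' (Domain r)"
        using rtrancl_distinct_list[OF xx] by blast
      have XR: "set X \<subseteq> R" using X(6) x'R by (auto simp: r_def)
      have "cyc (P' @ X)"
        unfolding cyc_def using P' X XR ux xv PQV by (auto simp: steps_append r_def R_def)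
      then have "length (P' @ X) \<le> length C" by (rule max)
      moreover have "length P' = length (P @ Q)"
        using P' cy unfolding cyc_def by (metis distinct_card set_append)
      ultimately show False using X(1) len by auto
    qed
    have x_ins: "\<not> insertable E P x"
    proof
      assume "insertable E P x"
      then obtain a b where ab: "(a, b) \<in> steps P" "(a, x) \<in> E" "(x, b) \<in> E"
        by (auto simp: insertable_def)
      obtain A B where PAB: "P = A @ a # b # B"
        using steps_split[OF ab(1)] by blast
      \<comment> \<open>Rotating so that \<open>a\<close> comes last and \<open>b\<close> first lets
        \<open>x\<close> be appended at the end.\<close>
      have "cyc ((A @ [a]) @ (b # B @ Q))" using cy PAB by simp
      then have "cyc ((b # B @ Q) @ (A @ [a]))" by (rule cyc_rotate)
      then have "cyc (((b # B @ Q) @ (A @ [a])) @ [x])"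
        using ab xR PAB unfolding cyc_def R_def by (subst steps_append) auto
      then have "length (((b # B @ Q) @ (A @ [a])) @ [x]) \<le> length C" by (rule max)
      then show False using len PAB by simp
    qed
    have yR: "y \<notin> R" "y \<in> V" "x \<in> V" "x \<noteq> y" using y PQV xR by (auto simp: R_def)
    \<comment> \<open>The case of \<open>x\<close> itself in both exclusions; in particular
      \<open>x\<close> and \<open>y\<close> are non-adjacent.\<close>
    have xQ: "links E x z = 0" if "z \<in> set Q" for z
      using no_out[OF that xR xx] no_in[OF that xR] by (simp add: links_def)
    have V: "(\<Sum>z\<in>V. f z) = (\<Sum>z\<in>set P. f z) + (\<Sum>z\<in>set Q. f z) + (\<Sum>z\<in>R. f z)" for f :: "'a \<Rightarrow> nat"
    proof -
      have "V = (set P \<union> set Q) \<union> R" "(set P \<union> set Q) \<inter> R = {}" using PQV by (auto simp: R_def)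
      moreover have "finite R" using finite_V by (simp add: R_def)
      ultimately show ?thesis using dist(3) by (simp add: sum.union_disjoint)
    qed
    \<comment> \<open>For \<open>z\<close> in \<open>R\<close> other than \<open>x\<close>, neither
      direction admits a path of length two between \<open>x\<close> and \<open>y\<close> through
      \<open>z\<close>, which leaves at most two of the four arcs.\<close>
    have "(\<Sum>z\<in>R. links E x z + links E y z) \<le> 2 * (card R - 1)"
    proof -
      have xy0: "links E y x = 0" using xQ[OF y(1)] by (simp add: links_def)
      have "(\<Sum>z\<in>R. links E x z + links E y z) = (\<Sum>z\<in>R - {x}. links E x z + links E y z)"
        using finite_V xR xy0 links_self by (intro sum.mono_neutral_right) (auto simp: R_def)
      also have "\<dots> \<le> (\<Sum>z\<in>R - {x}. 2)"
      proof (rule sum_mono)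
        fix z assume z: "z \<in> R - {x}"
        have "\<not> ((x, z) \<in> E \<and> (z, y) \<in> E)" using no_in[OF y(1), of z] z xR by (auto simp: r_def)
        moreover have "\<not> ((y, z) \<in> E \<and> (z, x) \<in> E)"
        proof
          assume a: "(y, z) \<in> E \<and> (z, x) \<in> E"
          then have "(z, x) \<in> r" using z xR by (auto simp: r_def)
          then have "(z, x') \<in> r\<^sup>*" using xx by (rule converse_rtrancl_into_rtrancl)
          then show False using no_out[OF y(1)] a z by blast
        qed
        ultimately show "links E x z + links E y z \<le> 2" by (auto simp: links_def)
      qed
      also have "\<dots> = 2 * (card R - 1)" using xR finite_V by (simp add: R_def)
      finally show ?thesis .
    qed
    moreover have "(\<Sum>z\<in>set Q. links E y z) \<le> 2 * (length Q - 1)"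
    proof -
      have "(\<Sum>z\<in>set Q. links E y z) = (\<Sum>z\<in>set Q - {y}. links E y z)"
        using y(1) by (simp add: sum.remove[of _ y] links_self)
      also have "\<dots> \<le> (\<Sum>z\<in>set Q - {y}. 2)" by (intro sum_mono links_le_2)
      also have "\<dots> = 2 * (length Q - 1)" using y(1) dist(2) by (simp add: distinct_card)
      finally show ?thesis .
    qed
    moreover have "(\<Sum>z\<in>set Q. links E x z) = 0" using xQ by simp
    moreover have "card V = length P + length Q + card R"
      using V[of "\<lambda>_. 1"] dist by (simp add: distinct_card)
    moreover have "card R > 0" using xR finite_V by (auto simp: R_def card_gt_0_iff)
    moreover have "length Q > 0" using y(1) by auto
    moreover have "2 * card V \<le> (\<Sum>z\<in>V. links E x z) + (\<Sum>z\<in>V. links E y z) + 1"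
      using xQ[OF y(1)] yR by (intro deg_sum) (auto simp: links_def split: if_splits)
    \<comment> \<open>Altogether at most
      \<open>2 (|P| + 1) + 2 (|Q| - 1) + 2 (|R| - 1) = 2 |V| - 2\<close>, one less than
      required.\<close>
    ultimately show False
      using sum_links_not_insertable[OF P dist(1) y(2)] sum_links_not_insertable[OF P dist(1) x_ins]
      unfolding V sum.distrib by linarith
  qed
  then show ?thesis using C that by blast
qed

section \<open>Existence of a vertex whose deletion preserves strong connectivity\<close>

text \<open>The paths of length two between non-adjacent \<open>x\<close> and \<open>y\<close>, in both directions, number at
  least three; it is used in the form that one per direction is not enough.\<close>

lemma two_paths:
  assumes "x \<in> V" "y \<in> V" "x \<noteq> y" "(x, y) \<notin> E" "(y, x) \<notin> E"
    and "\<And>z. (x, z) \<in> E \<Longrightarrow> (z, y) \<in> E \<Longrightarrow> z = a"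
    and "\<And>z. (y, z) \<in> E \<Longrightarrow> (z, x) \<in> E \<Longrightarrow> z = b"
  shows False
proof -
  have "(\<Sum>z\<in>V. links E x z) + (\<Sum>z\<in>V. links E y z) = (\<Sum>z\<in>V. links E x z + links E y z)"
    by (simp add: sum.distrib)
  also have "\<dots> = (\<Sum>z\<in>V - {x, y}. links E x z + links E y z)"
    using finite_V assms by (intro sum.mono_neutral_right) (auto simp: links_def E_irrefl)
  \<comment> \<open>The four possible arcs at \<open>z\<close> form two pairs, one per direction; a
    pair is complete only for \<open>z = a\<close> or \<open>z = b\<close> respectively.\<close>
  also have "\<dots> \<le> (\<Sum>z\<in>V - {x, y}. 2 + (of_bool (z = a) + of_bool (z = b)))"
    using assms(6,7) by (intro sum_mono) (auto simp: links_def)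
  also have "\<dots> = 2 * card (V - {x, y}) + (\<Sum>z\<in>V - {x, y}. of_bool (z = a)) + (\<Sum>z\<in>V - {x, y}. of_bool (z = b))"
    by (simp only: sum.distrib) simp
  also have "\<dots> \<le> 2 * card (V - {x, y}) + 1 + 1"
    using finite_V by (intro add_mono order.refl) (simp_all add: of_bool_def sum.delta)
  also have "card (V - {x, y}) = card V - 2" using assms by (simp add: card_Diff_subset)
  finally have "2 * card V \<le> 2 * (card V - 2) + 3"
    using deg_sum[OF assms(1-5)] by linarith
  moreover have "card {x, y} \<le> card V" using assms finite_V by (intro card_mono) auto
  ultimately show False using assms(3) by simp
qed

text \<open>Witnesses that \<open>w\<close> is a cut vertex: \<open>B\<close> can be left, and
  \<open>A\<close> entered, only through \<open>w\<close>.\<close>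

definition separation :: "'a \<Rightarrow> 'a set \<Rightarrow> 'a set \<Rightarrow> bool" where
  "separation w A B \<longleftrightarrow> w \<in> V \<and> w \<notin> A \<and> w \<notin> B \<and> A \<inter> B = {} \<and> A \<union> B \<union> {w} = V
     \<and> A \<noteq> {} \<and> B \<noteq> {} \<and> (\<forall>b\<in>B. \<forall>a\<in>A. (b, a) \<notin> E)"

lemma ex_separation:
  assumes "w \<in> V" "\<not> strong (V - {w}) E"
  shows "\<exists>A B. separation w A B"
proof -
  obtain B where "B \<subseteq> V - {w}" "B \<noteq> {}" "B \<noteq> V - {w}"
    "\<forall>b\<in>B. \<forall>a\<in>V - {w} - B. (b, a) \<notin> E"
    using assms(2) unfolding strong_def by blast
  then have "separation w (V - {w} - B) B" using assms(1) by (auto simp: separation_def)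
  then show ?thesis by blast
qed

lemma enterE:
  assumes "A \<subseteq> V" "A \<noteq> {}" "A \<noteq> V"
  obtains a b where "a \<in> A" "b \<in> V" "b \<notin> A" "(b, a) \<in> E"
  using strongD[OF strong_converse[OF strong] assms] by auto

text \<open>A smallest part, taken to be \<open>B\<close>, must be a single vertex \<open>v\<close> with \<open>w\<close> as its only
  out-neighbour. A separation at \<open>v\<close> then yields a set \<open>B'\<close> which can only be left through \<open>v\<close>, and
  the deletion of any \<open>t\<close> in \<open>B'\<close> does not destroy strong connectivity.\<close>

lemma no_smallest_separation:
  assumes sep: "separation w A B"
    and min: "\<And>w' A' B'. separation w' A' B' \<Longrightarrow> card B \<le> card A' \<and> card B \<le> card B'"
    and all: "\<And>w. w \<in> V \<Longrightarrow> \<exists>A B. separation w A B"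
    and card: "4 \<le> card V"
  shows False
proof -
  have w: "w \<in> V" "w \<notin> A" "w \<notin> B" and AB: "A \<inter> B = {}" "V = A \<union> B \<union> {w}"
    and Bne: "B \<noteq> {}" and BA: "\<And>b a. b \<in> B \<Longrightarrow> a \<in> A \<Longrightarrow> (b, a) \<notin> E"
    using sep by (auto simp: separation_def)
  obtain v where v: "v \<in> B" using Bne by blast
  obtain A' B' where sep': "separation v A' B'" using all[of v] v AB by blast
  have v': "v \<notin> A'" "v \<notin> B'" and AB': "A' \<inter> B' = {}" "V = A' \<union> B' \<union> {v}"
    and ne': "A' \<noteq> {}" "B' \<noteq> {}" and BA': "\<And>b a. b \<in> B' \<Longrightarrow> a \<in> A' \<Longrightarrow> (b, a) \<notin> E"
    using sep' by (auto simp: separation_def)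
  have finB: "finite B" using finite_V AB by simp
  have small: False if "X \<subseteq> B - {v}" "card B \<le> card X" for X
    using card_mono[OF _ that(1)] card_Diff1_less[OF finB v] that(2) finB by simp
  have wA': "w \<in> A'"
  proof (rule ccontr)
    assume "w \<notin> A'"
    then have wB': "w \<in> B'" using w AB' v by blast
    \<comment> \<open>An arc entering this set would start in \<open>B\<close> or in
      \<open>B'\<close>, and both are excluded.\<close>
    have "A' \<inter> A = {}"
    proof (rule ccontr)
      assume "A' \<inter> A \<noteq> {}"
      then obtain a b where "a \<in> A' \<inter> A" "b \<in> V" "b \<notin> A' \<inter> A" "(b, a) \<in> E"
        using enterE[of "A' \<inter> A"] AB w by blast
      then show False using BA BA' AB AB' v wB' by blast
    qed
    then have "A' \<subseteq> B - {v}" using AB AB' v' \<open>w \<notin> A'\<close> by blast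
    then show False using small min[OF sep'] by blast
  qed
  \<comment> \<open>As \<open>w\<close> lies in \<open>A'\<close>, the intersection can be left only
    through \<open>v\<close>, so it would be a smaller part of a separation at
    \<open>v\<close>.\<close>
  have "B \<inter> B' = {}"
  proof (rule ccontr)
    assume ne: "B \<inter> B' \<noteq> {}"
    have "separation v (V - {v} - (B \<inter> B')) (B \<inter> B')"
      unfolding separation_def using ne v v' AB AB' wA' w BA BA' by (auto 4 4)
    then show False using small[of "B \<inter> B'"] min v' by blast
  qed
  then have B'A: "B' \<subseteq> A" using AB AB' wA' by blast
  \<comment> \<open>A second vertex \<open>y\<close> of \<open>B\<close> and any \<open>x\<close> in
    \<open>B'\<close> are non-adjacent; paths of length two from \<open>x\<close> to
    \<open>y\<close> all pass through \<open>v\<close>, those back through \<open>w\<close>.\<close>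
  have Bv: "B = {v}"
  proof (rule ccontr)
    assume "B \<noteq> {v}"
    then obtain y where y: "y \<in> B" "y \<noteq> v" using v by blast
    then have yA': "y \<in> A'" using AB AB' \<open>B \<inter> B' = {}\<close> by blast
    obtain x where x: "x \<in> B'" using ne' by blast
    show False
    proof (rule two_paths[of x y v w])
      show "x \<in> V" "y \<in> V" "x \<noteq> y" using x y yA' AB AB' by auto
      show "(x, y) \<notin> E" using BA' x yA' by blast
      show "(y, x) \<notin> E" using BA B'A x y by blast
      show "z = v" if "(x, z) \<in> E" "(z, y) \<in> E" for z
        using that BA' x yA' AB' E_sub by blast
      show "z = w" if "(y, z) \<in> E" "(z, x) \<in> E" for z
        using that BA x y B'A AB E_sub by blast
    qed
  qed
  have v_out: "z = w" if "(v, z) \<in> E" for z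
    using that BA E_sub AB Bv E_irrefl by blast
  have T_out: "z \<in> insert v B'" if "(t, z) \<in> E" "t \<in> B'" for t z
    using that BA' E_sub AB' by blast
  obtain t where t: "t \<in> B'" using ne' by blast
  have tV: "t \<in> V" "t \<noteq> v" "t \<noteq> w" using t AB' v' wA' by auto
  obtain A2 B2 where sep2: "separation t A2 B2" using all[OF tV(1)] by blast
  have AB2: "A2 \<inter> B2 = {}" "V = A2 \<union> B2 \<union> {t}"
    and ne2: "A2 \<noteq> {}" "B2 \<noteq> {}" and BA2: "\<And>b a. b \<in> B2 \<Longrightarrow> a \<in> A2 \<Longrightarrow> (b, a) \<notin> E"
    using sep2 by (auto simp: separation_def)
  have vV: "v \<in> V" "v \<noteq> w" using v AB w by auto
  have vw: "(v, w) \<in> E"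
    using strongD[OF strong, of "{v}"] vV v_out w by (metis empty_subsetI insert_iff insert_not_empty insert_subset singletonD)
  \<comment> \<open>Paths of length two from \<open>v\<close> all pass through \<open>w\<close>, so
    those into \<open>v\<close> cannot all pass through one vertex \<open>b\<close>.\<close>
  have to_v: "(x, v) \<in> E \<or> (\<exists>z. z \<noteq> b \<and> (x, z) \<in> E \<and> (z, v) \<in> E)"
    if "x \<in> V" "x \<noteq> v" "x \<noteq> w" for x b
  proof (rule ccontr)
    assume "\<not> ?thesis"
    then show False using two_paths[of x v b w] v_out that vV by blast
  qed
  \<comment> \<open>Paths of length two from \<open>x\<close> to \<open>w\<close> all pass through
    \<open>v\<close>, so those from \<open>w\<close> to \<open>x\<close> cannot all pass through
    \<open>t\<close>.\<close>
  have from_w: "(w, x) \<in> E \<or> (\<exists>z. z \<noteq> t \<and> (w, z) \<in> E \<and> (z, x) \<in> E)" if "x \<in> B'" for x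
  proof (rule ccontr)
    assume n: "\<not> ?thesis"
    have xw: "x \<in> V" "x \<noteq> w" "(x, w) \<notin> E" using that AB' wA' T_out[of x w] w v v' by auto
    have "z = v" if "(x, z) \<in> E" "(z, w) \<in> E" for z
      using that \<open>x \<in> B'\<close> T_out[of x z] T_out[of z w] wA' AB' w vV by blast
    then show False using two_paths[of w x t v] n xw w by blast
  qed
  show False
  proof (cases "w \<in> B2")
    case True
    \<comment> \<open>An arc entering this set cannot start in \<open>B'\<close>, in particular not
      at \<open>t\<close>, so it would start in \<open>B2\<close> or in \<open>B\<close>.\<close>
    have "A2 \<inter> (A - B') = {}"
    proof (rule ccontr)
      assume "A2 \<inter> (A - B') \<noteq> {}"
      then obtain a b where ab: "a \<in> A2 \<inter> (A - B')" "b \<in> V" "b \<notin> A2 \<inter> (A - B')" "(b, a) \<in> E"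
        using enterE[of "A2 \<inter> (A - B')"] AB w by blast
      have "b \<notin> B'" using T_out[of b a] ab v AB by blast
      then show False using ab True BA[of b a] BA2[of b a] AB AB2 t by blast
    qed
    moreover have "A2 \<inter> B' = {}"
    proof (rule ccontr)
      assume "A2 \<inter> B' \<noteq> {}"
      then obtain x where x: "x \<in> A2" "x \<in> B'" by blast
      consider "(w, x) \<in> E" | z where "z \<noteq> t" "(w, z) \<in> E" "(z, x) \<in> E"
        using from_w[OF x(2)] by blast
      then show False using BA2 True x(1) AB2 E_sub by cases blast+
    qed
    ultimately have "x = v" if "x \<in> A2" for x
      using that True AB2 AB(2) Bv by (metis DiffI IntI UnE UnI1 empty_iff singletonD)
    then have A2: "A2 = {v}" using ne2(1) by blast
    \<comment> \<open>A fourth vertex has an arc to \<open>v\<close> or a path of length two to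
      \<open>v\<close> avoiding \<open>t\<close>, although \<open>t\<close> is the only in-neighbour
      of \<open>v\<close>.\<close>
    have "\<exists>x. x \<in> V - {v, w, t}"
    proof -
      have "card {v, w, t} \<le> 3" by (simp add: card_insert_if)
      then have "\<not> V \<subseteq> {v, w, t}" using card card_mono[of "{v, w, t}" V] by fastforce
      then show ?thesis by blast
    qed
    then obtain x where x: "x \<in> V" "x \<noteq> v" "x \<noteq> w" "x \<noteq> t" by blast
    have "z = t" if "(z, v) \<in> E" for z
      using that BA2 AB2 A2 E_sub E_irrefl by blast
    then show False using to_v[OF x(1-3), of t] x by blast
  next
    case False
    then have wA2: "w \<in> A2" using AB2 w tV by blast
    \<comment> \<open>From \<open>x\<close> in \<open>B2\<close> the vertex \<open>v\<close> in
      \<open>A2\<close> is reached without using \<open>t\<close>, which the separation at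
      \<open>t\<close> forbids.\<close>
    obtain x where x: "x \<in> B2" using ne2 by blast
    have vB2: "v \<notin> B2" using vw wA2 BA2 by blast
    then have "x \<in> V" "x \<noteq> v" "x \<noteq> w" using x AB2 False by auto
    then consider "(x, v) \<in> E" | z where "z \<noteq> t" "(x, z) \<in> E" "(z, v) \<in> E"
      using to_v[of x t] by blast
    then show False using vB2 BA2 x AB2 E_sub vV tV by cases blast+
  qed
qed

text \<open>Reversing all arcs exchanges the two parts of a separation, which reduces the case of a
  smallest part \<open>A\<close> to that of a smallest part \<open>B\<close>.\<close>

lemma meyniel_converse: "meyniel V (E\<inverse>)"
proof
  show "2 * card V \<le> (\<Sum>z\<in>V. links (E\<inverse>) x z) + (\<Sum>z\<in>V. links (E\<inverse>) y z) + 1"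
    if "x \<in> V" "y \<in> V" "x \<noteq> y" "(x, y) \<notin> E\<inverse>" "(y, x) \<notin> E\<inverse>" for x y
    using deg_sum[of x y] that by (simp add: links_def add.commute)
qed (use finite_V E_sub E_irrefl strong_converse[OF strong] in auto)

lemma separation_converse: "meyniel.separation V (E\<inverse>) w A B \<longleftrightarrow> separation w B A"
  unfolding separation_def meyniel.separation_def[OF meyniel_converse] by auto

theorem ex_noncut_vertex:
  assumes "4 \<le> card V"
  shows "\<exists>w\<in>V. strong (V - {w}) E"
proof (rule ccontr)
  assume "\<not> ?thesis"
  then have all: "\<exists>A B. separation w A B" if "w \<in> V" for w
    using ex_separation that by blast
  define side where "side n \<longleftrightarrow> (\<exists>w A B. separation w A B \<and> (card A = n \<or> card B = n))" for n
  obtain w where "w \<in> V" using assms by fastforce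
  then have "\<exists>n. side n" using all unfolding side_def by blast
  then obtain n where n: "side n" and least: "\<And>m. side m \<Longrightarrow> n \<le> m"
    by (metis LeastI_ex Least_le)
  have le: "n \<le> card A \<and> n \<le> card B" if "separation w A B" for w A B
    using that least unfolding side_def by blast
  obtain w A B where sep: "separation w A B" and AB: "card A = n \<or> card B = n"
    using n unfolding side_def by blast
  show False
  proof (cases "card B = n")
    case True
    show False
      by (rule no_smallest_separation[OF sep _ all assms]) (use True le in auto)
  next
    case False
    interpret conv: meyniel V "E\<inverse>" by (rule meyniel_converse)
    have "\<exists>A B. conv.separation w A B" if "w \<in> V" for w
      using all[OF that] separation_converse by blast
    moreover have "card A \<le> card A' \<and> card A \<le> card B'" if "conv.separation w' A' B'" for w' A' B'
      using le[of w' B' A'] that False AB by (auto simp: separation_converse)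
    moreover have "conv.separation w B A" using sep by (simp add: separation_converse)
    ultimately show False using conv.no_smallest_separation[of w B A] assms by blast
  qed
qed

end

section \<open>Reversing the arcs at a vertex\<close>

definition flip :: "'a \<Rightarrow> 'a rel \<Rightarrow> 'a rel" where
  "flip w E = {(a, b). if a = w \<or> b = w then (b, a) \<in> E else (a, b) \<in> E}"

lemma links_flip: "links (flip w E) x y = links E x y"
  by (simp add: links_def flip_def)

context meyniel
begin

text \<open>A cut that splits the other vertices is crossed by an arc avoiding \<open>w\<close>,
  which is kept; the cuts \<open>{w}\<close> and \<open>V - {w}\<close> are crossed by reversed arcs
  at \<open>w\<close>.\<close>

lemma strong_flip:
  assumes w: "w \<in> V" and st: "strong (V - {w}) E" and card: "2 \<le> card V"
  shows "strong V (flip w E)"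
  unfolding strong_def
proof (intro allI impI)
  fix A assume A: "A \<subseteq> V" "A \<noteq> {}" "A \<noteq> V"
  have wV: "{w} \<noteq> V" using card by auto
  show "\<exists>a\<in>A. \<exists>b\<in>V - A. (a, b) \<in> flip w E"
  proof (cases "A - {w} = {} \<or> A - {w} = V - {w}")
    case False
    then obtain a b where "a \<in> A - {w}" "b \<in> V - {w}" "b \<notin> A - {w}" "(a, b) \<in> E"
      using strongD[OF st, of "A - {w}"] A by blast
    then show ?thesis by (auto simp: flip_def)
  next
    case True
    then consider "A = {w}" | "A = V - {w}" using A w by blast
    then show ?thesis
    proof cases
      case 1
      obtain b where "b \<in> V" "b \<noteq> w" "(b, w) \<in> E" using enterE[of "{w}"] w wV by blast
      then show ?thesis using 1 by (auto simp: flip_def)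
    next
      case 2
      obtain b where "b \<in> V" "b \<noteq> w" "(w, b) \<in> E"
        using strongD[OF strong, of "{w}"] w wV by blast
      then show ?thesis using 2 w by (auto simp: flip_def)
    qed
  qed
qed

lemma meyniel_flip:
  assumes w: "w \<in> V" and st: "strong (V - {w}) E" and card: "2 \<le> card V"
  shows "meyniel V (flip w E)"
proof
  show "2 * card V \<le> (\<Sum>z\<in>V. links (flip w E) x z) + (\<Sum>z\<in>V. links (flip w E) y z) + 1"
    if "x \<in> V" "y \<in> V" "x \<noteq> y" "(x, y) \<notin> flip w E" "(y, x) \<notin> flip w E" for x y
    unfolding links_flip using that by (intro deg_sum) (auto simp: flip_def split: if_splits)
qed (use finite_V E_sub E_irrefl strong_flip[OF assms] in \<open>auto simp: flip_def split: if_splits\<close>)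

text \<open>A Hamiltonian cycle \<open>w # L\<close> of the flipped digraph keeps its arcs along
  \<open>L\<close>, while its two arcs at \<open>w\<close> turn into a path from \<open>hd L\<close>
  through \<open>w\<close> to \<open>last L\<close>.\<close>

theorem ex_D_p_3:
  assumes "4 \<le> card V"
  obtains w L where "w \<in> V" "distinct L" "set L = V - {w}" "L \<noteq> []" "steps L \<subseteq> E"
    "(hd L, w) \<in> E" "(w, last L) \<in> E"
proof -
  obtain w where w: "w \<in> V" "strong (V - {w}) E" using ex_noncut_vertex[OF assms] by blast
  interpret F: meyniel V "flip w E" using meyniel_flip[OF w] assms by simp
  have "2 \<le> card V" using assms by simp
  then obtain C where C: "F.cyc C" "set C = V" by (rule F.hamiltonian)
  then have "w \<in> set C" using w(1) by simp
  then obtain A B where AB: "C = A @ w # B" by (meson split_list)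
  define L where "L = B @ A"
  have c: "F.cyc (w # L)" using F.cyc_rotate[of A "w # B"] C AB by (simp add: L_def)
  have "distinct (w # L)" using c unfolding F.cyc_def by blast
  moreover have "insert w (set L) = V" unfolding C(2)[symmetric] AB L_def by auto
  ultimately have L: "set L = V - {w}" "distinct L" by auto
  have cardL: "card (set L) = card V - 1" using L(1) w(1) by (simp add: card_Diff_singleton)
  have "L \<noteq> []"
  proof
    assume "L = []"
    then show False using cardL assms by simp
  qed
  moreover have "steps (w # L) \<subseteq> flip w E" "(last (w # L), hd (w # L)) \<in> flip w E"
    using c by (simp_all only: F.cyc_def)
  ultimately have s: "steps L \<subseteq> flip w E" "(w, hd L) \<in> flip w E" "(last L, w) \<in> flip w E"
    unfolding steps_Cons[OF \<open>L \<noteq> []\<close>] by simp_all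
  have "(a, b) \<in> E" if ab: "(a, b) \<in> steps L" for a b
  proof -
    obtain X Y where XY: "L = X @ a # b # Y" using steps_split[OF ab] by blast
    have "a \<in> set L" "b \<in> set L" unfolding XY by simp_all
    then have "a \<noteq> w" "b \<noteq> w" unfolding L(1) by blast+
    moreover have "(a, b) \<in> flip w E" using ab s(1) by blast
    ultimately show ?thesis by (simp add: flip_def)
  qed
  then have "steps L \<subseteq> E" by (rule subrelI)
  moreover have "(hd L, w) \<in> E" "(w, last L) \<in> E" using s(2,3) by (simp_all add: flip_def)
  ultimately show ?thesis using that w(1) L \<open>L \<noteq> []\<close> by blast
qed

end

section \<open>Transfer to library digraphs\<close>

context digraph
begin

text \<open>A set that no arc leaves contains everything reachable from it.\<close>

lemma strong_arcs_ends:
  assumes "strongly_connected G"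
  shows "strong (verts G) (arcs_ends G)"
  unfolding strong_def
proof (intro allI impI)
  fix A assume A: "A \<subseteq> verts G" "A \<noteq> {}" "A \<noteq> verts G"
  then obtain a b where ab: "a \<in> A" "b \<in> verts G" "b \<notin> A" by blast
  then have "a \<rightarrow>\<^sup>*\<^bsub>G\<^esub> b" using assms A by (auto elim: strongly_connectedE)
  then have "b \<in> A" if "\<not> (\<exists>a\<in>A. \<exists>b\<in>verts G - A. (a, b) \<in> arcs_ends G)"
  proof (induction rule: reachable_induct)
    case base
    then show ?case using ab by simp
  next
    case (step x y)
    then show ?case using that adj_in_verts(2)[of x y] by auto
  qed
  then show "\<exists>a\<in>A. \<exists>b\<in>verts G - A. (a, b) \<in> arcs_ends G" using ab by blast
qed

text \<open>Without multiple arcs, the arcs out of \<open>x\<close> correspond to their heads and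
  those into \<open>x\<close> to their tails.\<close>

lemma total_degree_links:
  "total_degree G x = (\<Sum>z\<in>verts G. links (arcs_ends G) x z)"
proof -
  have "bij_betw (head G) (out_arcs G x) {z \<in> verts G. (x, z) \<in> arcs_ends G}"
    using no_multi_arcs unfolding bij_betw_def inj_on_def
    by (auto simp: arcs_ends_def arc_to_ends_def image_iff)
  then have o: "out_degree G x = card {z \<in> verts G. (x, z) \<in> arcs_ends G}"
    unfolding out_degree_def by (rule bij_betw_same_card)
  have "bij_betw (tail G) (in_arcs G x) {z \<in> verts G. (z, x) \<in> arcs_ends G}"
    using no_multi_arcs unfolding bij_betw_def inj_on_def
    by (auto simp: arcs_ends_def arc_to_ends_def image_iff)
  then have i: "in_degree G x = card {z \<in> verts G. (z, x) \<in> arcs_ends G}"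
    unfolding in_degree_def by (rule bij_betw_same_card)
  show ?thesis
    unfolding total_degree_def o i links_def sum.distrib
    by (simp add: of_bool_def sum.If_cases Int_def)
qed

lemma awalk_of_steps:
  "L \<noteq> [] \<Longrightarrow> set L \<subseteq> verts G \<Longrightarrow> steps L \<subseteq> arcs_ends G \<Longrightarrow>
    \<exists>q. awalk (hd L) q (last L) \<and> awalk_verts (hd L) q = L"
proof (induction L rule: steps.induct)
  case (1 x y zs)
  then obtain q where q: "awalk y q (last (y # zs))" "awalk_verts y q = y # zs" by auto
  obtain e where e: "e \<in> arcs G" "tail G e = x" "head G e = y"
    using 1(4) by (auto simp: arcs_ends_def arc_to_ends_def)
  show ?case
    using q e by (intro exI[of _ "e # q"]) (auto simp: awalk_Cons_iff)
next
  case (2 x)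
  then show ?case by (intro exI[of _ "[]"]) (auto simp: awalk_Nil_iff)
qed auto

end

theorem theorem1p19:
  fixes G :: "('a, 'b) pre_digraph" and p :: nat
  assumes "digraph G"
    and "strongly_connected G"
    and "card (verts G) = p" and "p \<ge> 4"
    and "\<And>x y. x \<in> verts G \<Longrightarrow> y \<in> verts G \<Longrightarrow> x \<noteq> y \<Longrightarrow> \<not> adjacent G x y \<Longrightarrow>
           total_degree G x + total_degree G y \<ge> 2 * p - 1"
  shows "\<exists>u w v. u \<in> verts G \<and> w \<in> verts G \<and> v \<in> verts G \<and>
           u \<noteq> w \<and> w \<noteq> v \<and> u \<noteq> v \<and>
           u \<rightarrow>\<^bsub>G\<^esub> w \<and> w \<rightarrow>\<^bsub>G\<^esub> v \<and>
           (\<exists>q. pre_digraph.apath G u q v \<and> length q = p - 2 \<and>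
                set (pre_digraph.awalk_verts G u q) = verts G - {w})"
proof -
  interpret digraph G by fact
  interpret meyniel "verts G" "arcs_ends G"
  proof
    show "strong (verts G) (arcs_ends G)" using assms(2) by (rule strong_arcs_ends)
    show "2 * card (verts G) \<le>
      (\<Sum>z\<in>verts G. links (arcs_ends G) x z) + (\<Sum>z\<in>verts G. links (arcs_ends G) y z) + 1"
      if "x \<in> verts G" "y \<in> verts G" "x \<noteq> y" "(x, y) \<notin> arcs_ends G" "(y, x) \<notin> arcs_ends G" for x y
      using assms(5)[OF that(1-3)] that(4,5) assms(3)
      by (auto simp: adjacent_def total_degree_links)
  qed (auto dest: adj_not_same)
  obtain w L where w: "w \<in> verts G" and L: "distinct L" "set L = verts G - {w}" "L \<noteq> []"
    "steps L \<subseteq> arcs_ends G" and arcs: "(hd L, w) \<in> arcs_ends G" "(w, last L) \<in> arcs_ends G"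
    using ex_D_p_3 assms(3,4) by metis
  obtain q where q: "awalk (hd L) q (last L)" "awalk_verts (hd L) q = L"
    using awalk_of_steps L by (metis Diff_subset)
  have len: "length L = p - 1"
    using L(1,2) w assms(3) by (metis card_Diff_singleton distinct_card)
  have "length L = Suc (length q)" using q(2) length_awalk_verts by metis
  then have "length q = p - 2" using len by simp
  moreover have "hd L \<noteq> last L"
    using len assms(4) L(1,3) by (cases L) auto
  moreover have "hd L \<in> verts G - {w}" "last L \<in> verts G - {w}" using L(2,3) by force+
  moreover have "apath (hd L) q (last L)" using q L(1) by (simp add: apath_def)
  moreover have "set (awalk_verts (hd L) q) = verts G - {w}" using q(2) L(2) by simp
  ultimately show ?thesis
    using w arcs
    by - (rule exI[of _ "hd L"], rule exI[of _ w], rule exI[of _ "last L"], blast)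
qed

end
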